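(* (i) (Odd.) For all $n\ge1$, $\Lambda_{2n+1}$ is the union of the consecutive disjoint intervals $\Lambda_{2n-1}+L_{2n}$, $\Lambda_{2n-2}+L_{2n+1}$, $\Lambda_{2n-1}+L_{2n+1}$, and $$\gamma^-(N)=\gamma^-(N-L_{2n})\,10\ \ (N\in\Lambda_{2n-1}+L_{2n}),\quad \gamma^-(N)=\gamma^-(N-L_{2n+1})\,0010\ \ (N\in\Lambda_{2n-2}+L_{2n+1}),$$ $$\gamma^-(N)=\gamma^-(N-L_{2n+1})\,00\ \ (N\in\Lambda_{2n-1}+L_{2n+1}).$$ (ii) (Even.) For all $n\ge1$, $\Lambda_{2n+2}$ is the union of the consecutive disjoint intervals $\Lambda_{2n}+L_{2n+1}$, $\Lambda_{2n-1}+L_{2n+2}$, $\Lambda_{2n}+L_{2n+2}$, and $$\gamma^-(N)=\gamma^-(N-L_{2n+1})\,00\ \ (N\in\Lambda_{2n}+L_{2n+1}),\quad \gamma^-(N)=\gamma^-(N-L_{2n+2})\,01\ \ (N\in\Lambda_{2n-1}+L_{2n+2}),$$ $$\gamma^-(N)=\gamma^-(N-L_{2n+1})\,01\ \ (N\in\Lambda_{2n}+L_{2n+2}).$$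
   Context: Let $\varphi=(1+\sqrt5)/2$. Every integer $N\ge1$ has a unique base phi expansion $N=\sum_{i\in\mathbb Z} d_i\varphi^i$ with $d_i\in\{0,1\}$, finitely many nonzero, $d_id_{i+1}=0$; with $R$ the smallest index with $d_R=1$, $\beta^-(N)=d_{-1}\cdots d_R$. For $N\ge2$, $\beta^-(N)$ ends in $01$, and $\gamma^-(N)$ is $\beta^-(N)$ with this final $01$ removed; juxtaposition denotes concatenation of words. Lucas numbers: $L_0=2$, $L_1=1$, $L_n=L_{n-1}+L_{n-2}$; Lucas intervals (integer intervals) $\Lambda_{2n}=[L_{2n},L_{2n+1}]$, $\Lambda_{2n+1}=[L_{2n+1}+1,L_{2n+2}-1]$ ($\Lambda_0=\emptyset$); $A+x=\{a+x:a\in A\}$.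
   Formalization: In the third formula of (ii), γ⁻(N−L_{2n+1})01 is replaced by γ⁻(N−L_{2n+2})01 for N in Λ_{2n}+L_{2n+2}; as printed it is false, e.g. n=1, N=10: γ⁻(10)=01 but γ⁻(6)01=0001. *)

theory Defs
  imports Complex_Main
begin

definition phi :: real where
  "phi = (1 + sqrt 5) / 2"

definition is_base_phi_expansion :: "nat \<Rightarrow> (int \<Rightarrow> nat) \<Rightarrow> bool" where
  "is_base_phi_expansion N d \<longleftrightarrow>
     (\<forall>i. d i \<in> {0, 1}) \<and> finite {i. d i \<noteq> 0} \<and> (\<forall>i. d i * d (i + 1) = 0) \<and>
     real N = (\<Sum>i | d i \<noteq> 0. real (d i) * phi powi i)"

text \<open>The description is proper for \<open>N \<ge> 1\<close>, by existence and uniqueness of the expansion.\<close>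

definition base_phi :: "nat \<Rightarrow> int \<Rightarrow> nat" where
  "base_phi N = (THE d. is_base_phi_expansion N d)"

text \<open>The word \<open>d\<^sub>-\<^sub>1 \<dots> d\<^sub>R\<close>, most significant digit first. It is empty if \<open>R \<ge> 0\<close>, which
  happens only for \<open>N = 1\<close>.\<close>

definition beta_minus :: "nat \<Rightarrow> nat list" where
  "beta_minus N =
     (let R = Min {i. base_phi N i = 1} in map (base_phi N) (rev [R..-1]))"

text \<open>Unspecified unless \<open>beta_minus N\<close> ends in \<open>01\<close>, which it does for \<open>N \<ge> 2\<close>.\<close>

definition gamma_minus :: "nat \<Rightarrow> nat list" where
  "gamma_minus N = (THE w. beta_minus N = w @ [0, 1])"

fun lucas :: "nat \<Rightarrow> nat" where
  "lucas 0 = 2"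
| "lucas (Suc 0) = 1"
| "lucas (Suc (Suc n)) = lucas (Suc n) + lucas n"

definition lucas_interval :: "nat \<Rightarrow> nat set" where
  "lucas_interval k =
     (if even k then {lucas k..lucas (k + 1)} else {lucas k + 1..lucas (k + 1) - 1})"

definition translate :: "nat set \<Rightarrow> nat \<Rightarrow> nat set" where
  "translate A x = {a + x | a. a \<in> A}"

text \<open>Each interval begins where the previous one stops, so the three are pairwise disjoint and
  leave no gap. Empty intervals are allowed: \<open>lucas_interval 0\<close> is empty.\<close>

definition consecutive_intervals :: "nat set \<Rightarrow> nat set \<Rightarrow> nat set \<Rightarrow> bool" where
  "consecutive_intervals A B C \<longleftrightarrow>
     (\<exists>a b c d. a \<le> b \<and> b \<le> c \<and> c \<le> d \<and> A = {a..<b} \<and> B = {b..<c} \<and> C = {c..<d})"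

lemma consecutive_intervals_disjoint:
  assumes "consecutive_intervals A B C"
  shows "A \<inter> B = {}" and "B \<inter> C = {}" and "A \<inter> C = {}"
  using assms by (auto simp: consecutive_intervals_def)

end

theory Submission
  imports Defs
begin

text \<open>By uniqueness of the expansion it suffices to exhibit the digits of \<open>M + L\<close>, given those of
  \<open>M\<close>. Since \<open>L\<^sub>2\<^sub>k = \<phi>\<^sup>2\<^sup>k + \<phi>\<^sup>-\<^sup>2\<^sup>k\<close> and \<open>L\<^sub>2\<^sub>k\<^sub>+\<^sub>1 = \<phi>\<^sup>2\<^sup>k\<^sup>+\<^sup>1 - \<phi>\<^sup>-\<^sup>2\<^sup>k\<^sup>-\<^sup>1\<close>, adding a Lucas number changes only the
  digits at the two ends of the expansion. This is because the first and last index of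
  the expansion of \<open>M\<close> depend only on the Lucas interval that contains \<open>M\<close>: they are \<open>2n\<close> and \<open>-2n\<close>
  on \<open>\<Lambda>\<^sub>2\<^sub>n\<close>, and \<open>2n+1\<close> and \<open>-2n-2\<close> on \<open>\<Lambda>\<^sub>2\<^sub>n\<^sub>+\<^sub>1\<close>. The recursion itself propagates this fact.\<close>

section \<open>Sums of non-consecutive powers of the golden ratio\<close>

lemma phi_gt_1: "phi > 1"
  by (simp add: phi_def)

lemma phi_squared: "phi * phi = phi + 1"
  by (simp add: phi_def field_simps)

lemma phi_powi_Suc: "phi powi (i + 1) = phi * phi powi i"
  using phi_gt_1 by (simp add: power_int_add)

text \<open>The exponents are tied by equations, so that shapes such as \<open>2 * k + 3\<close>,
  \<open>2 * k + 2\<close>, \<open>2 * k + 1\<close> match directly.\<close>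

lemma phi_powi_rec:
  assumes "j = i + 1" "l = i + 2"
  shows "phi powi l = phi powi j + phi powi i"
proof -
  have "phi powi l = (phi * phi) * phi powi i"
    using phi_gt_1 assms by (simp add: power_int_add power2_eq_square)
  also have "\<dots> = phi * phi powi i + phi powi i"
    by (simp add: phi_squared ring_distribs)
  finally show ?thesis
    by (simp only: assms phi_powi_Suc)
qed

lemma phi_powi_pos: "phi powi i > 0"
  using phi_gt_1 by (simp add: zero_less_power_int)

lemma phi_powi_mono: "i \<le> j \<Longrightarrow> phi powi i \<le> phi powi j"
  using phi_gt_1 by (simp add: power_int_increasing)

text \<open>Remove the largest index \<open>m\<close>. The others are at most \<open>m - 2\<close>,
  so by induction they contribute less than \<open>phi powi (m - 1)\<close>, and the total stays
  below \<open>phi powi (m + 1)\<close>.\<close>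

lemma sum_phi_powi_less:
  assumes "finite S" "\<forall>i\<in>S. i + 1 \<notin> S" "\<forall>i\<in>S. i < t"
  shows "(\<Sum>i\<in>S. phi powi i) < phi powi t"
  using assms
proof (induction "card S" arbitrary: S t rule: less_induct)
  case less
  show ?case
  proof (cases "S = {}")
    case True
    then show ?thesis by (simp add: phi_powi_pos)
  next
    case False
    define m where "m = Max S"
    have m: "m \<in> S" "\<forall>i\<in>S. i \<le> m"
      using False less.prems by (auto simp: m_def)
    have below: "i < m - 1" if "i \<in> S - {m}" for i
    proof -
      have "i \<le> m" "i \<noteq> m" "i + 1 \<noteq> m"
        using that m less.prems by auto
      then show ?thesis by linarith
    qed
    have "(\<Sum>i\<in>S. phi powi i) = phi powi m + (\<Sum>i\<in>S - {m}. phi powi i)"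
      using m less.prems by (simp add: sum.remove)
    also have "(\<Sum>i\<in>S - {m}. phi powi i) < phi powi (m - 1)"
      using m less.prems below
      by (intro less.hyps card_Diff1_less) auto
    also have "phi powi m + phi powi (m - 1) = phi powi (m + 1)"
      by (rule phi_powi_rec[symmetric]) simp_all
    also have "\<dots> \<le> phi powi t"
      using m less.prems by (intro phi_powi_mono) auto
    finally show ?thesis by simp
  qed
qed

text \<open>The largest index \<open>t\<close> of the symmetric difference decides: above
  \<open>t\<close> the sets agree, and below \<open>t\<close> the set without \<open>t\<close>
  cannot make up for \<open>phi powi t\<close>.\<close>

lemma sum_phi_powi_inject:
  assumes S: "finite S" "\<forall>i\<in>S. i + 1 \<notin> S"
    and T: "finite T" "\<forall>i\<in>T. i + 1 \<notin> T"
    and eq: "(\<Sum>i\<in>S. phi powi i) = (\<Sum>i\<in>T. phi powi i)"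
  shows "S = T"
proof (rule ccontr)
  \<comment> \<open>Stated for arbitrary \<open>A\<close> and \<open>B\<close>, since
    \<open>t\<close> may lie in either of \<open>S\<close> and \<open>T\<close>.\<close>
  have less: "(\<Sum>i\<in>B. phi powi i) < (\<Sum>i\<in>A. phi powi i)"
    if "finite A" and B: "finite B" "\<forall>i\<in>B. i + 1 \<notin> B"
      and t: "t \<in> A" "t \<notin> B" and above: "\<And>i. t < i \<Longrightarrow> i \<in> A \<longleftrightarrow> i \<in> B" for A B t
  proof -
    define U where "U = {i\<in>A. t < i}"
    have "i < t \<or> t < i" if "i \<in> B" for i
      using t that by (metis linorder_neqE)
    then have "B = {i\<in>B. i < t} \<union> U"
      using above by (auto simp: U_def)
    then have "(\<Sum>i\<in>B. phi powi i) = (\<Sum>i\<in>{i\<in>B. i < t} \<union> U. phi powi i)"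
      by (rule arg_cong)
    also have "\<dots> = (\<Sum>i\<in>{i\<in>B. i < t}. phi powi i) + (\<Sum>i\<in>U. phi powi i)"
      using that by (intro sum.union_disjoint) (auto simp: U_def)
    also have "(\<Sum>i\<in>{i\<in>B. i < t}. phi powi i) < phi powi t"
      using B by (intro sum_phi_powi_less) auto
    also have "phi powi t + (\<Sum>i\<in>U. phi powi i) = (\<Sum>i\<in>insert t U. phi powi i)"
      using \<open>finite A\<close> by (simp add: U_def)
    also have "\<dots> \<le> (\<Sum>i\<in>A. phi powi i)"
      using that by (intro sum_mono2) (auto simp: U_def less_imp_le[OF phi_powi_pos])
    finally show ?thesis by simp
  qed
  assume "S \<noteq> T"
  define D where "D = (S - T) \<union> (T - S)"
  have D: "finite D" "D \<noteq> {}"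
    using S T \<open>S \<noteq> T\<close> by (auto simp: D_def)
  define t where "t = Max D"
  have t: "t \<in> D"
    using D by (simp add: t_def)
  have above: "i \<in> S \<longleftrightarrow> i \<in> T" if "t < i" for i
  proof -
    have "i \<notin> D"
      using that D Max_ge[of D i] by (auto simp: t_def)
    then show ?thesis by (auto simp: D_def)
  qed
  from t consider "t \<in> S" "t \<notin> T" | "t \<in> T" "t \<notin> S"
    by (auto simp: D_def)
  then show False
  proof cases
    case 1
    then show ?thesis using less[of S T t] S T above eq by simp
  next
    case 2
    then show ?thesis using less[of T S t] S T above eq by simp
  qed
qed

section \<open>Digits of the base phi expansion\<close>

text \<open>An expansion is encoded by the set of places of its digits 1. Both extreme places are
  recorded because a Lucas number is added there.\<close>

definition phi_expansion :: "int \<Rightarrow> int \<Rightarrow> nat \<Rightarrow> int set \<Rightarrow> bool" where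
  "phi_expansion t b N S \<longleftrightarrow>
     S \<subseteq> {b..t} \<and> b \<in> S \<and> t \<in> S \<and> (\<forall>i\<in>S. i + 1 \<notin> S) \<and> real N = (\<Sum>i\<in>S. phi powi i)"

lemma finite_phi_expansion: "phi_expansion t b N S \<Longrightarrow> finite S"
  by (auto simp: phi_expansion_def intro: finite_subset)

lemma phi_expansion_next_digit: "phi_expansion t b N S \<Longrightarrow> i = b + 1 \<Longrightarrow> i \<notin> S"
  by (auto simp: phi_expansion_def)

text \<open>One exhibited expansion evaluates the \<open>THE\<close>: the support of any other is a
  set without neighbours and with the same sum, hence equal to \<open>S\<close>.\<close>

lemma base_phi_eq:
  assumes "phi_expansion t b N S"
  shows "base_phi N = (\<lambda>i. of_bool (i \<in> S))"
  unfolding base_phi_def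
proof (rule the_equality)
  have "{i. of_bool (i \<in> S) \<noteq> (0::nat)} = S"
    by auto
  then show "is_base_phi_expansion N (\<lambda>i. of_bool (i \<in> S))"
    using assms finite_phi_expansion[OF assms]
    unfolding is_base_phi_expansion_def phi_expansion_def
    by (auto intro!: sum.cong)
next
  fix d assume d: "is_base_phi_expansion N d"
  have d01: "d i = 1" if "d i \<noteq> 0" for i
  proof -
    have "d i \<in> {0, 1}"
      using d unfolding is_base_phi_expansion_def by blast
    then show ?thesis using that by simp
  qed
  have sum_d: "(\<Sum>i | d i \<noteq> 0. real (d i) * phi powi i) = (\<Sum>i | d i \<noteq> 0. phi powi i)"
    by (rule sum.cong) (simp_all add: d01)
  have nonadj: "\<forall>i\<in>{i. d i \<noteq> 0}. i + 1 \<notin> {i. d i \<noteq> 0}"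
  proof
    fix i assume "i \<in> {i. d i \<noteq> 0}"
    moreover have "d i * d (i + 1) = 0"
      using d unfolding is_base_phi_expansion_def by blast
    ultimately show "i + 1 \<notin> {i. d i \<noteq> 0}"
      by simp
  qed
  have "{i. d i \<noteq> 0} = S"
    using sum_d d assms finite_phi_expansion[OF assms]
    by (intro sum_phi_powi_inject nonadj) (simp_all add: is_base_phi_expansion_def phi_expansion_def)
  then have "i \<in> S \<longleftrightarrow> d i \<noteq> 0" for i
    by auto
  then show "d = (\<lambda>i. of_bool (i \<in> S))"
    using d01 by (intro ext) (metis of_bool_eq)
qed

section \<open>Reading the word \<open>gamma_minus\<close> off the digits\<close>

lemma upto_eq_Cons2:
  assumes "b \<le> -2"
  shows "[b..-1] = b # (b + 1) # [b + 2..-1]"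
  using assms upto_rec1[of b "-1"] upto_rec1[of "b + 1" "-1"] by (simp add: add.assoc)

text \<open>The last digit 1 is at \<open>b\<close> and excludes a 1 at \<open>b + 1\<close>. Both
  places are negative, so they form the final 01 that is removed.\<close>

lemma gamma_minus_eq:
  assumes S: "phi_expansion t b N S" and b: "b \<le> -2"
  shows "gamma_minus N = map (\<lambda>i. of_bool (i \<in> S)) (rev [b + 2..-1])"
proof -
  have "b \<in> S" "b + 1 \<notin> S"
    using S by (auto simp: phi_expansion_def)
  have "{i. base_phi N i = 1} = S"
    by (auto simp: base_phi_eq[OF S])
  moreover have "Min S = b"
    using S finite_phi_expansion[OF S]
    by (intro Min_eqI) (auto simp: phi_expansion_def)
  ultimately have "beta_minus N = map (\<lambda>i. of_bool (i \<in> S)) (rev [b..-1])"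
    by (simp add: beta_minus_def base_phi_eq[OF S])
  also have "\<dots> = map (\<lambda>i. of_bool (i \<in> S)) (rev [b + 2..-1]) @ [0, 1]"
    using \<open>b \<in> S\<close> \<open>b + 1 \<notin> S\<close> by (simp add: upto_eq_Cons2[OF b])
  finally show ?thesis
    by (simp add: gamma_minus_def)
qed

text \<open>When the last place drops by two, the word, which used to stop at \<open>b + 2\<close>,
  now stops at \<open>b\<close>. It gains the two places of the old final 01, with their new
  digits.\<close>

lemma gamma_minus_extend2:
  assumes S: "phi_expansion t b M S" and b: "b \<le> -2"
    and S': "phi_expansion t' b' N S'" and "b' = b - 2" "i = b + 1"
    and agree: "\<And>i. b + 2 \<le> i \<Longrightarrow> i < 0 \<Longrightarrow> i \<in> S' \<longleftrightarrow> i \<in> S"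
  shows "gamma_minus N = gamma_minus M @ [of_bool (i \<in> S'), of_bool (b \<in> S')]"
  using gamma_minus_eq[OF S b] gamma_minus_eq[OF S'] assms
  by (simp add: upto_eq_Cons2[OF b])

lemma gamma_minus_extend4:
  assumes S: "phi_expansion t b M S" and b: "b \<le> -2"
    and S': "phi_expansion t' b' N S'" and "b' = b - 4" "i = b + 1" "j = b - 1" "l = b - 2"
    and agree: "\<And>i. b + 2 \<le> i \<Longrightarrow> i < 0 \<Longrightarrow> i \<in> S' \<longleftrightarrow> i \<in> S"
  shows "gamma_minus N = gamma_minus M @
    [of_bool (i \<in> S'), of_bool (b \<in> S'), of_bool (j \<in> S'), of_bool (l \<in> S')]"
  using gamma_minus_eq[OF S b] gamma_minus_eq[OF S'] assms upto_eq_Cons2[of "b - 2"]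
  by (simp add: upto_eq_Cons2[OF b])

text \<open>The digits in \<open>X\<close> are erased and those in \<open>Y\<close> written;
  \<open>c\<close> is the resulting change of value.\<close>

lemma phi_expansion_update:
  assumes S: "phi_expansion t b M S"
    and XY: "X \<subseteq> S" "Y \<inter> S = {}" "finite Y"
    and S': "S' = S - X \<union> Y" "S' \<subseteq> {b'..t'}" "b' \<in> S'" "t' \<in> S'" "\<forall>i\<in>S'. i + 1 \<notin> S'"
    and c: "real c + (\<Sum>i\<in>X. phi powi i) = (\<Sum>i\<in>Y. phi powi i)"
  shows "phi_expansion t' b' (M + c) S'"
proof -
  have fin: "finite S"
    using S by (rule finite_phi_expansion)
  have "(\<Sum>i\<in>S'. phi powi i) = (\<Sum>i\<in>S - X. phi powi i) + (\<Sum>i\<in>Y. phi powi i)"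
    unfolding S'(1) using XY fin by (intro sum.union_disjoint) auto
  also have "(\<Sum>i\<in>S - X. phi powi i) = (\<Sum>i\<in>S. phi powi i) - (\<Sum>i\<in>X. phi powi i)"
    using XY fin by (simp add: sum_diff)
  finally show ?thesis
    using S S' c by (auto simp: phi_expansion_def)
qed

section \<open>Adding a Lucas number\<close>

text \<open>Binet's formula: the conjugate of \<open>phi\<close> is \<open>-1 / phi\<close>, and
  both geometric sequences satisfy the Lucas recurrence.\<close>

lemma lucas_eq: "real (lucas k) = phi powi int k + (-1) ^ k * phi powi (- int k)"
proof (induction k rule: lucas.induct)
  case 1
  then show ?case by simp
next
  case 2
  have "1 / phi = phi - 1"
    using phi_squared phi_gt_1 by (simp add: field_simps)
  then show ?case by (simp add: field_simps)
next
  case (3 n)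
  have "phi powi (int n + 2) = phi powi (int n + 1) + phi powi int n"
    by (rule phi_powi_rec) simp_all
  moreover have "phi powi (- int n) = phi powi (- 1 - int n) + phi powi (- int n - 2)"
    by (rule phi_powi_rec) simp_all
  ultimately show ?case
    using 3 by (simp add: ring_distribs add.commute)
qed

lemma lucas_even:
  "even m \<Longrightarrow> i = int m \<Longrightarrow> j = - int m \<Longrightarrow> real (lucas m) = phi powi i + phi powi j"
  by (simp add: lucas_eq)

lemma lucas_odd:
  "odd m \<Longrightarrow> i = int m \<Longrightarrow> j = - int m \<Longrightarrow> real (lucas m) = phi powi i - phi powi j"
  by (simp add: lucas_eq)

section \<open>Expansions with prescribed ends, and the six additions\<close>

definition even_type :: "nat \<Rightarrow> nat \<Rightarrow> bool" where
  "even_type n N \<longleftrightarrow> (\<exists>S. phi_expansion (2 * int n) (- 2 * int n) N S)"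

text \<open>The condition \<open>- 2 * int n \<notin> S\<close> says that \<open>gamma_minus N\<close> does not end in \<open>1\<close>
  (for \<open>n \<ge> 1\<close>). It prevents a carry when \<open>2 * phi powi (- 2 * int n - 2)\<close> is rewritten as
  \<open>phi powi (- 2 * int n - 1) + phi powi (- 2 * int n - 4)\<close>.\<close>

definition odd_type :: "nat \<Rightarrow> nat \<Rightarrow> bool" where
  "odd_type n N \<longleftrightarrow>
     (\<exists>S. phi_expansion (2 * int n + 1) (- 2 * int n - 2) N S \<and> - 2 * int n \<notin> S)"

lemma even_typeI:
  "phi_expansion t b N S \<Longrightarrow> t = 2 * int n \<Longrightarrow> b = - 2 * int n \<Longrightarrow> even_type n N"
  by (auto simp: even_type_def)

lemma odd_typeI:
  "phi_expansion t b N S \<Longrightarrow> i \<notin> S \<Longrightarrow> t = 2 * int n + 1 \<Longrightarrow> b = - 2 * int n - 2 \<Longrightarrow>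
    i = - 2 * int n \<Longrightarrow> odd_type n N"
  by (auto simp: odd_type_def)

text \<open>At the top, phi^(2n+1) and phi^(2n) merge into phi^(2n+2). At the bottom, phi^(-2n)
  minus phi^(-2n-1) leaves phi^(-2n-2). As n >= 1, the two ends are distinct.\<close>

lemma even_add_odd_lucas:
  assumes "even_type n M" "n \<ge> 1"
  shows "even_type (n + 1) (M + lucas (2 * n + 1))"
    and "gamma_minus (M + lucas (2 * n + 1)) = gamma_minus M @ [0, 0]"
proof -
  define k where "k = int n"
  have k: "k \<ge> 1"
    using assms by (simp add: k_def)
  obtain S where S: "phi_expansion (2 * k) (- 2 * k) M S"
    using assms by (auto simp: even_type_def k_def)
  define S' where "S' = S - {2 * k, - 2 * k} \<union> {2 * k + 2, - 2 * k - 2}"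
  have S_facts: "S \<subseteq> {- 2 * k..2 * k}" "- 2 * k \<in> S" "2 * k \<in> S"
    "\<And>i. i \<in> S \<Longrightarrow> i + 1 \<notin> S"
    using S by (auto simp: phi_expansion_def)
  have next_digit: "- 2 * k + 1 \<notin> S"
    by (rule phi_expansion_next_digit[OF S]) simp
  have S': "phi_expansion (2 * k + 2) (- 2 * k - 2) (M + lucas (2 * n + 1)) S'"
  proof (rule phi_expansion_update[OF S _ _ _ S'_def])
    have "real (lucas (2 * n + 1)) = phi powi (2 * k + 1) - phi powi (- 2 * k - 1)"
      by (rule lucas_odd) (simp_all add: k_def)
    moreover have "phi powi (2 * k + 2) = phi powi (2 * k + 1) + phi powi (2 * k)"
      by (rule phi_powi_rec) simp_all
    moreover have "phi powi (- 2 * k) = phi powi (- 2 * k - 1) + phi powi (- 2 * k - 2)"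
      by (rule phi_powi_rec) simp_all
    ultimately show "real (lucas (2 * n + 1)) + (\<Sum>i\<in>{2 * k, - 2 * k}. phi powi i) =
        (\<Sum>i\<in>{2 * k + 2, - 2 * k - 2}. phi powi i)"
      using k by simp
    show "\<forall>i\<in>S'. i + 1 \<notin> S'"
    proof (intro ballI notI)
      fix i assume "i \<in> S'" "i + 1 \<in> S'"
      then show False
        using S_facts(1) S_facts(4)[of i] S_facts(4)[of "i + 1"] S_facts(2,3) k
        unfolding S'_def by auto
    qed
  qed (use S_facts next_digit k in \<open>auto simp: S'_def\<close>)
  show "even_type (n + 1) (M + lucas (2 * n + 1))"
    by (rule even_typeI[OF S']) (simp_all add: k_def)
  have "gamma_minus (M + lucas (2 * n + 1)) =
      gamma_minus M @ [of_bool (- 2 * k + 1 \<in> S'), of_bool (- 2 * k \<in> S')]"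
    by (rule gamma_minus_extend2[OF S _ S']) (use k in \<open>auto simp: S'_def\<close>)
  then show "gamma_minus (M + lucas (2 * n + 1)) = gamma_minus M @ [0, 0]"
    using S_facts next_digit k by (auto simp: S'_def)
qed

text \<open>Both new powers lie two places outside the old ends, so there is no carry, and the old
  final 01 stays in the word.\<close>

lemma even_add_even_lucas:
  assumes "even_type n M" "n \<ge> 1"
  shows "even_type (n + 1) (M + lucas (2 * n + 2))"
    and "gamma_minus (M + lucas (2 * n + 2)) = gamma_minus M @ [0, 1]"
proof -
  define k where "k = int n"
  have k: "k \<ge> 1"
    using assms by (simp add: k_def)
  obtain S where S: "phi_expansion (2 * k) (- 2 * k) M S"
    using assms by (auto simp: even_type_def k_def)
  define S' where "S' = S \<union> {2 * k + 2, - 2 * k - 2}"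
  have S_facts: "S \<subseteq> {- 2 * k..2 * k}" "- 2 * k \<in> S" "2 * k \<in> S"
    "\<And>i. i \<in> S \<Longrightarrow> i + 1 \<notin> S"
    using S by (auto simp: phi_expansion_def)
  have next_digit: "- 2 * k + 1 \<notin> S"
    by (rule phi_expansion_next_digit[OF S]) simp
  have S': "phi_expansion (2 * k + 2) (- 2 * k - 2) (M + lucas (2 * n + 2)) S'"
  proof (rule phi_expansion_update[OF S, where X = "{}" and Y = "{2 * k + 2, - 2 * k - 2}"])
    have "real (lucas (2 * n + 2)) = phi powi (2 * k + 2) + phi powi (- 2 * k - 2)"
      by (rule lucas_even) (simp_all add: k_def)
    then show "real (lucas (2 * n + 2)) + (\<Sum>i\<in>{}. phi powi i) =
        (\<Sum>i\<in>{2 * k + 2, - 2 * k - 2}. phi powi i)"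
      using k by simp
    show "\<forall>i\<in>S'. i + 1 \<notin> S'"
    proof (intro ballI notI)
      fix i assume "i \<in> S'" "i + 1 \<in> S'"
      then show False
        using S_facts(1) S_facts(4)[of i] S_facts(4)[of "i + 1"] S_facts(2,3) k
        unfolding S'_def by auto
    qed
  qed (use S_facts next_digit k in \<open>auto simp: S'_def\<close>)
  show "even_type (n + 1) (M + lucas (2 * n + 2))"
    by (rule even_typeI[OF S']) (simp_all add: k_def)
  have "gamma_minus (M + lucas (2 * n + 2)) =
      gamma_minus M @ [of_bool (- 2 * k + 1 \<in> S'), of_bool (- 2 * k \<in> S')]"
    by (rule gamma_minus_extend2[OF S _ S']) (use k in \<open>auto simp: S'_def\<close>)
  then show "gamma_minus (M + lucas (2 * n + 2)) = gamma_minus M @ [0, 1]"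
    using S_facts next_digit k by (auto simp: S'_def)
qed

text \<open>Again no carry: the new top is three places above the old one (hence
  \<open>skip\<close>), and the new bottom two places below.\<close>

lemma odd_add_even_lucas_skip:
  assumes "odd_type n M"
  shows "even_type (n + 2) (M + lucas (2 * n + 4))"
    and "gamma_minus (M + lucas (2 * n + 4)) = gamma_minus M @ [0, 1]"
proof -
  define k where "k = int n"
  have k: "k \<ge> 0"
    by (simp add: k_def)
  obtain S where S: "phi_expansion (2 * k + 1) (- 2 * k - 2) M S"
    using assms by (auto simp: odd_type_def k_def)
  define S' where "S' = S \<union> {2 * k + 4, - 2 * k - 4}"
  have S_facts: "S \<subseteq> {- 2 * k - 2..2 * k + 1}" "- 2 * k - 2 \<in> S" "2 * k + 1 \<in> S"
    "\<And>i. i \<in> S \<Longrightarrow> i + 1 \<notin> S"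
    using S by (auto simp: phi_expansion_def)
  have next_digit: "- 2 * k - 1 \<notin> S"
    by (rule phi_expansion_next_digit[OF S]) simp
  have S': "phi_expansion (2 * k + 4) (- 2 * k - 4) (M + lucas (2 * n + 4)) S'"
  proof (rule phi_expansion_update[OF S, where X = "{}" and Y = "{2 * k + 4, - 2 * k - 4}"])
    have "real (lucas (2 * n + 4)) = phi powi (2 * k + 4) + phi powi (- 2 * k - 4)"
      by (rule lucas_even) (simp_all add: k_def)
    then show "real (lucas (2 * n + 4)) + (\<Sum>i\<in>{}. phi powi i) =
        (\<Sum>i\<in>{2 * k + 4, - 2 * k - 4}. phi powi i)"
      using k by simp
    show "\<forall>i\<in>S'. i + 1 \<notin> S'"
    proof (intro ballI notI)
      fix i assume "i \<in> S'" "i + 1 \<in> S'"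
      then show False
        using S_facts(1) S_facts(4)[of i] S_facts(4)[of "i + 1"] S_facts(2,3) k
        unfolding S'_def by auto
    qed
  qed (use S_facts next_digit k in \<open>auto simp: S'_def\<close>)
  show "even_type (n + 2) (M + lucas (2 * n + 4))"
    by (rule even_typeI[OF S']) (simp_all add: k_def)
  have "gamma_minus (M + lucas (2 * n + 4)) =
      gamma_minus M @ [of_bool (- 2 * k - 1 \<in> S'), of_bool (- 2 * k - 2 \<in> S')]"
    by (rule gamma_minus_extend2[OF S _ S']) (use k in \<open>auto simp: S'_def\<close>)
  then show "gamma_minus (M + lucas (2 * n + 4)) = gamma_minus M @ [0, 1]"
    using S_facts next_digit k by (auto simp: S'_def)
qed

text \<open>The top merges into phi^(2n+3). At the bottom 2 phi^(-2n-2) = phi^(-2n-1) + phi^(-2n-4),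
  which turns the old final 01 into 10.\<close>

lemma odd_add_even_lucas:
  assumes "odd_type n M"
  shows "odd_type (n + 1) (M + lucas (2 * n + 2))"
    and "gamma_minus (M + lucas (2 * n + 2)) = gamma_minus M @ [1, 0]"
proof -
  define k where "k = int n"
  have k: "k \<ge> 0"
    by (simp add: k_def)
  obtain S where S: "phi_expansion (2 * k + 1) (- 2 * k - 2) M S" and low: "- 2 * k \<notin> S"
    using assms by (auto simp: odd_type_def k_def)
  define S' where "S' = S - {2 * k + 1, - 2 * k - 2} \<union> {2 * k + 3, - 2 * k - 1, - 2 * k - 4}"
  have S_facts: "S \<subseteq> {- 2 * k - 2..2 * k + 1}" "- 2 * k - 2 \<in> S" "2 * k + 1 \<in> S"
    "\<And>i. i \<in> S \<Longrightarrow> i + 1 \<notin> S"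
    using S by (auto simp: phi_expansion_def)
  have next_digit: "- 2 * k - 1 \<notin> S"
    by (rule phi_expansion_next_digit[OF S]) simp
  have S': "phi_expansion (2 * k + 3) (- 2 * k - 4) (M + lucas (2 * n + 2)) S'"
  proof (rule phi_expansion_update[OF S _ _ _ S'_def])
    have "real (lucas (2 * n + 2)) = phi powi (2 * k + 2) + phi powi (- 2 * k - 2)"
      by (rule lucas_even) (simp_all add: k_def)
    moreover have "phi powi (2 * k + 3) = phi powi (2 * k + 2) + phi powi (2 * k + 1)"
      by (rule phi_powi_rec) simp_all
    moreover have "phi powi (- 2 * k - 1) = phi powi (- 2 * k - 2) + phi powi (- 2 * k - 3)"
      by (rule phi_powi_rec) simp_all
    moreover have "phi powi (- 2 * k - 2) = phi powi (- 2 * k - 3) + phi powi (- 2 * k - 4)"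
      by (rule phi_powi_rec) simp_all
    ultimately show "real (lucas (2 * n + 2)) + (\<Sum>i\<in>{2 * k + 1, - 2 * k - 2}. phi powi i) =
        (\<Sum>i\<in>{2 * k + 3, - 2 * k - 1, - 2 * k - 4}. phi powi i)"
      using k by simp
    show "\<forall>i\<in>S'. i + 1 \<notin> S'"
    proof (intro ballI notI)
      fix i assume "i \<in> S'" "i + 1 \<in> S'"
      then show False
        using S_facts(1) S_facts(4)[of i] S_facts(4)[of "i + 1"] S_facts(2,3) k low
        unfolding S'_def by auto
    qed
  qed (use S_facts next_digit k in \<open>auto simp: S'_def\<close>)
  \<comment> \<open>This is the extra condition of \<open>odd_type\<close> for
    \<open>n + 1\<close>.\<close>
  have low': "- 2 * k - 2 \<notin> S'"
    using S_facts next_digit k by (auto simp: S'_def)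
  show "odd_type (n + 1) (M + lucas (2 * n + 2))"
    by (rule odd_typeI[OF S' low']) (simp_all add: k_def)
  have "gamma_minus (M + lucas (2 * n + 2)) =
      gamma_minus M @ [of_bool (- 2 * k - 1 \<in> S'), of_bool (- 2 * k - 2 \<in> S')]"
    by (rule gamma_minus_extend2[OF S _ S']) (use k in \<open>auto simp: S'_def\<close>)
  then show "gamma_minus (M + lucas (2 * n + 2)) = gamma_minus M @ [1, 0]"
    using S_facts next_digit k by (auto simp: S'_def)
qed

text \<open>Expanding phi^(-2n) as phi^(-2n-1) + phi^(-2n-3) + phi^(-2n-4), the subtracted
  phi^(-2n-3) cancels. The bottom drops by four places, hence four new letters.\<close>

lemma even_add_odd_lucas_skip:
  assumes "even_type n M" "n \<ge> 1"
  shows "odd_type (n + 1) (M + lucas (2 * n + 3))"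
    and "gamma_minus (M + lucas (2 * n + 3)) = gamma_minus M @ [0, 0, 1, 0]"
proof -
  define k where "k = int n"
  have k: "k \<ge> 1"
    using assms by (simp add: k_def)
  obtain S where S: "phi_expansion (2 * k) (- 2 * k) M S"
    using assms by (auto simp: even_type_def k_def)
  define S' where "S' = S - {- 2 * k} \<union> {2 * k + 3, - 2 * k - 1, - 2 * k - 4}"
  have S_facts: "S \<subseteq> {- 2 * k..2 * k}" "- 2 * k \<in> S" "2 * k \<in> S"
    "\<And>i. i \<in> S \<Longrightarrow> i + 1 \<notin> S"
    using S by (auto simp: phi_expansion_def)
  have next_digit: "- 2 * k + 1 \<notin> S"
    by (rule phi_expansion_next_digit[OF S]) simp
  have S': "phi_expansion (2 * k + 3) (- 2 * k - 4) (M + lucas (2 * n + 3)) S'"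
  proof (rule phi_expansion_update[OF S _ _ _ S'_def])
    have "real (lucas (2 * n + 3)) = phi powi (2 * k + 3) - phi powi (- 2 * k - 3)"
      by (rule lucas_odd) (simp_all add: k_def)
    moreover have "phi powi (- 2 * k) = phi powi (- 2 * k - 1) + phi powi (- 2 * k - 2)"
      by (rule phi_powi_rec) simp_all
    moreover have "phi powi (- 2 * k - 2) = phi powi (- 2 * k - 3) + phi powi (- 2 * k - 4)"
      by (rule phi_powi_rec) simp_all
    ultimately show "real (lucas (2 * n + 3)) + (\<Sum>i\<in>{- 2 * k}. phi powi i) =
        (\<Sum>i\<in>{2 * k + 3, - 2 * k - 1, - 2 * k - 4}. phi powi i)"
      using k by simp
    show "\<forall>i\<in>S'. i + 1 \<notin> S'"
    proof (intro ballI notI)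
      fix i assume "i \<in> S'" "i + 1 \<in> S'"
      then show False
        using S_facts(1) S_facts(4)[of i] S_facts(4)[of "i + 1"] S_facts(2,3) k
        unfolding S'_def by auto
    qed
  qed (use S_facts next_digit k in \<open>auto simp: S'_def\<close>)
  have low': "- 2 * k - 2 \<notin> S'"
    using S_facts next_digit k by (auto simp: S'_def)
  show "odd_type (n + 1) (M + lucas (2 * n + 3))"
    by (rule odd_typeI[OF S' low']) (simp_all add: k_def)
  have "gamma_minus (M + lucas (2 * n + 3)) =
      gamma_minus M @ [of_bool (- 2 * k + 1 \<in> S'), of_bool (- 2 * k \<in> S'),
        of_bool (- 2 * k - 1 \<in> S'), of_bool (- 2 * k - 2 \<in> S')]"
    by (rule gamma_minus_extend4[OF S _ S']) (use k in \<open>auto simp: S'_def\<close>)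
  then show "gamma_minus (M + lucas (2 * n + 3)) = gamma_minus M @ [0, 0, 1, 0]"
    using S_facts next_digit k by (auto simp: S'_def)
qed

text \<open>The subtracted phi^(-2n-3) turns phi^(-2n-2) into phi^(-2n-4), while phi^(2n+3) is
  placed two above the old top.\<close>

lemma odd_add_odd_lucas:
  assumes "odd_type n M"
  shows "odd_type (n + 1) (M + lucas (2 * n + 3))"
    and "gamma_minus (M + lucas (2 * n + 3)) = gamma_minus M @ [0, 0]"
proof -
  define k where "k = int n"
  have k: "k \<ge> 0"
    by (simp add: k_def)
  obtain S where S: "phi_expansion (2 * k + 1) (- 2 * k - 2) M S"
    using assms by (auto simp: odd_type_def k_def)
  define S' where "S' = S - {- 2 * k - 2} \<union> {2 * k + 3, - 2 * k - 4}"
  have S_facts: "S \<subseteq> {- 2 * k - 2..2 * k + 1}" "- 2 * k - 2 \<in> S" "2 * k + 1 \<in> S"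
    "\<And>i. i \<in> S \<Longrightarrow> i + 1 \<notin> S"
    using S by (auto simp: phi_expansion_def)
  have next_digit: "- 2 * k - 1 \<notin> S"
    by (rule phi_expansion_next_digit[OF S]) simp
  have S': "phi_expansion (2 * k + 3) (- 2 * k - 4) (M + lucas (2 * n + 3)) S'"
  proof (rule phi_expansion_update[OF S _ _ _ S'_def])
    have "real (lucas (2 * n + 3)) = phi powi (2 * k + 3) - phi powi (- 2 * k - 3)"
      by (rule lucas_odd) (simp_all add: k_def)
    moreover have "phi powi (- 2 * k - 2) = phi powi (- 2 * k - 3) + phi powi (- 2 * k - 4)"
      by (rule phi_powi_rec) simp_all
    ultimately show "real (lucas (2 * n + 3)) + (\<Sum>i\<in>{- 2 * k - 2}. phi powi i) =
        (\<Sum>i\<in>{2 * k + 3, - 2 * k - 4}. phi powi i)"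
      using k by simp
    show "\<forall>i\<in>S'. i + 1 \<notin> S'"
    proof (intro ballI notI)
      fix i assume "i \<in> S'" "i + 1 \<in> S'"
      then show False
        using S_facts(1) S_facts(4)[of i] S_facts(4)[of "i + 1"] S_facts(2,3) k
        unfolding S'_def by auto
    qed
  qed (use S_facts next_digit k in \<open>auto simp: S'_def\<close>)
  have low': "- 2 * k - 2 \<notin> S'"
    using S_facts next_digit k by (auto simp: S'_def)
  show "odd_type (n + 1) (M + lucas (2 * n + 3))"
    by (rule odd_typeI[OF S' low']) (simp_all add: k_def)
  have "gamma_minus (M + lucas (2 * n + 3)) =
      gamma_minus M @ [of_bool (- 2 * k - 1 \<in> S'), of_bool (- 2 * k - 2 \<in> S')]"
    by (rule gamma_minus_extend2[OF S _ S']) (use k in \<open>auto simp: S'_def\<close>)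
  then show "gamma_minus (M + lucas (2 * n + 3)) = gamma_minus M @ [0, 0]"
    using S_facts next_digit k by (auto simp: S'_def)
qed

section \<open>Lucas intervals\<close>

lemma lucas_pos: "lucas n > 0"
  by (induction n rule: lucas.induct) auto

text \<open>The summand 1 accommodates n = 0, where the half-open form of the empty interval is
  \<open>{2..<2}\<close>.\<close>

lemma lucas_even_le: "lucas (2 * n) \<le> lucas (2 * n + 1) + 1"
proof (cases n)
  case (Suc m)
  then show ?thesis by simp
qed simp

lemma translate_atLeastLessThan: "translate {a..<b} x = {a + x..<b + x}"
  by (simp only: translate_def Setcompr_eq_image Collect_mem_eq image_add_atLeastLessThan')

lemma lucas_interval_even: "lucas_interval (2 * n) = {lucas (2 * n)..<lucas (2 * n + 1) + 1}"
  by (auto simp: lucas_interval_def)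

lemma lucas_interval_odd: "lucas_interval (2 * n + 1) = {lucas (2 * n + 1) + 1..<lucas (2 * n + 2)}"
  using lucas_pos[of "2 * n + 2"] by (auto simp: lucas_interval_def)

lemma consecutive_union:
  assumes "a \<le> b" "b \<le> c" "c \<le> d" "A = {a..<b}" "B = {b..<c}" "C = {c..<d}" "D = {a..<d}"
  shows "consecutive_intervals A B C \<and> D = A \<union> B \<union> C"
  using assms by (auto simp: consecutive_intervals_def)

lemma odd_interval_split:
  "consecutive_intervals
     (translate (lucas_interval (2 * n + 1)) (lucas (2 * n + 2)))
     (translate (lucas_interval (2 * n)) (lucas (2 * n + 3)))
     (translate (lucas_interval (2 * n + 1)) (lucas (2 * n + 3))) \<and>
   lucas_interval (2 * n + 3) =
     translate (lucas_interval (2 * n + 1)) (lucas (2 * n + 2)) \<union>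
     translate (lucas_interval (2 * n)) (lucas (2 * n + 3)) \<union>
     translate (lucas_interval (2 * n + 1)) (lucas (2 * n + 3))"
  unfolding lucas_interval_even lucas_interval_odd translate_atLeastLessThan
  using lucas_pos[of "2 * n"] lucas_even_le[of n] lucas_interval_odd[of "n + 1"]
  \<comment> \<open>Each cut has two forms, equal by the recurrence: for \<open>b\<close>, 2
    L_(2n+2) = L_(2n) + L_(2n+3).\<close>
  by (intro consecutive_union[where a = "lucas (2 * n + 3) + 1" and b = "2 * lucas (2 * n + 2)"
        and c = "lucas (2 * n + 1) + lucas (2 * n + 3) + 1" and d = "lucas (2 * n + 4)"])
     (auto simp: numeral_eq_Suc)

lemma even_interval_split:
  "consecutive_intervals
     (translate (lucas_interval (2 * n + 2)) (lucas (2 * n + 3)))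
     (translate (lucas_interval (2 * n + 1)) (lucas (2 * n + 4)))
     (translate (lucas_interval (2 * n + 2)) (lucas (2 * n + 4))) \<and>
   lucas_interval (2 * n + 4) =
     translate (lucas_interval (2 * n + 2)) (lucas (2 * n + 3)) \<union>
     translate (lucas_interval (2 * n + 1)) (lucas (2 * n + 4)) \<union>
     translate (lucas_interval (2 * n + 2)) (lucas (2 * n + 4))"
  using lucas_interval_even[of "n + 1"] lucas_interval_even[of "n + 2"]
    lucas_pos[of "2 * n"] lucas_even_le[of "n + 1"]
  unfolding lucas_interval_odd
  \<comment> \<open>Here \<open>b\<close> rests on 2 L_(2n+3) = L_(2n+1) + L_(2n+4).\<close>
  by (intro consecutive_union[where a = "lucas (2 * n + 4)" and b = "2 * lucas (2 * n + 3) + 1"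
        and c = "lucas (2 * n + 2) + lucas (2 * n + 4)" and d = "lucas (2 * n + 5) + 1"])
     (auto simp: numeral_eq_Suc translate_atLeastLessThan)

section \<open>The ends of the expansions on the Lucas intervals\<close>

lemma small_types: "odd_type 0 2" "even_type 1 3" "even_type 1 4"
proof -
  have powers: "phi powi 2 = phi + 1" "phi powi 1 = phi powi 0 + phi powi (-1)"
    "phi powi 0 = phi powi (-1) + phi powi (-2)"
    using phi_powi_rec[of 1 0 2] phi_powi_rec[of 0 "-1" 1] phi_powi_rec[of "-1" "-2" 0] by auto
  have "phi_expansion 2 (-2) 3 {2, -2}" "phi_expansion 2 (-2) 4 {2, 0, -2}"
    "phi_expansion 1 (-2) 2 {1, -2}"
    using powers by (auto simp: phi_expansion_def)
  then show "odd_type 0 2" "even_type 1 3" "even_type 1 4"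
    by (auto intro: even_typeI odd_typeI[where i = 0])
qed

text \<open>Three successive intervals are carried along because the splittings of the next two
  refer back to all of them. The last conjunct for \<open>n\<close> is the middle one for
  \<open>Suc n\<close>.\<close>

lemma types_of_lucas_intervals:
  "(\<forall>M\<in>lucas_interval (2 * n + 1). odd_type n M) \<and>
   (n \<ge> 1 \<longrightarrow> (\<forall>M\<in>lucas_interval (2 * n). even_type n M)) \<and>
   (\<forall>M\<in>lucas_interval (2 * n + 2). even_type (n + 1) M)"
proof (induction n)
  case 0
  have "lucas_interval 1 = {2}" "lucas_interval 2 = {3, 4}"
    by (auto simp: lucas_interval_def numeral_eq_Suc)
  then show ?case
    using small_types by (simp flip: numeral_2_eq_2)
next
  case (Suc n)
  have 0: "lucas_interval 0 = {}"
    by (simp add: lucas_interval_def)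
  have idx: "2 * (n + 1) + 1 = 2 * n + 3" "2 * (n + 1) + 2 = 2 * n + 4"
    by simp_all
  have "odd_type (n + 1) N" if N: "N \<in> lucas_interval (2 * n + 3)" for N
  proof -
    from N odd_interval_split[of n]
    consider M where "M \<in> lucas_interval (2 * n + 1)" "N = M + lucas (2 * n + 2)"
      | M where "M \<in> lucas_interval (2 * n)" "N = M + lucas (2 * n + 3)"
      | M where "M \<in> lucas_interval (2 * n + 1)" "N = M + lucas (2 * n + 3)"
      unfolding translate_def by blast
    then show ?thesis
    proof cases
      case 1
      then show ?thesis using Suc.IH odd_add_even_lucas(1) by blast
    next
      case (2 M)
      \<comment> \<open>This piece is empty for n = 0, so the bound required by
        \<open>even_add_odd_lucas_skip\<close> is available.\<close>
      then have "n \<ge> 1"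
        using 0 by (cases n) auto
      then show ?thesis using 2 Suc.IH even_add_odd_lucas_skip(1) by blast
    next
      case 3
      then show ?thesis using Suc.IH odd_add_odd_lucas(1) by blast
    qed
  qed
  moreover have "even_type (n + 2) N" if N: "N \<in> lucas_interval (2 * n + 4)" for N
  proof -
    from N even_interval_split[of n]
    consider M where "M \<in> lucas_interval (2 * n + 2)" "N = M + lucas (2 * n + 3)"
      | M where "M \<in> lucas_interval (2 * n + 1)" "N = M + lucas (2 * n + 4)"
      | M where "M \<in> lucas_interval (2 * n + 2)" "N = M + lucas (2 * n + 4)"
      unfolding translate_def by blast
    then show ?thesis
    proof cases
      case (1 M)
      then show ?thesis using Suc.IH even_add_odd_lucas(1)[of "n + 1" M, unfolded idx]
        by (simp del: lucas.simps)
    next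
      case 2
      then show ?thesis using Suc.IH odd_add_even_lucas_skip(1) by blast
    next
      case (3 M)
      then show ?thesis using Suc.IH even_add_even_lucas(1)[of "n + 1" M, unfolded idx]
        by (simp del: lucas.simps)
    qed
  qed
  ultimately show ?case
    using Suc.IH by (simp add: eval_nat_numeral)
qed

text \<open>In the last clause the translation by \<open>lucas (2*n + 2)\<close> itself is undone.
  Subtracting \<open>lucas (2*n + 1)\<close> there would fail for n = 1, N = 10: the words of 10 and
  6 are 01 and 00.\<close>

theorem theorem7p5:
  shows "(\<forall>n\<ge>1.
      consecutive_intervals
        (translate (lucas_interval (2*n - 1)) (lucas (2*n)))
        (translate (lucas_interval (2*n - 2)) (lucas (2*n + 1)))
        (translate (lucas_interval (2*n - 1)) (lucas (2*n + 1))) \<and>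
      lucas_interval (2*n + 1) =
        translate (lucas_interval (2*n - 1)) (lucas (2*n)) \<union>
        translate (lucas_interval (2*n - 2)) (lucas (2*n + 1)) \<union>
        translate (lucas_interval (2*n - 1)) (lucas (2*n + 1)) \<and>
      (\<forall>N \<in> translate (lucas_interval (2*n - 1)) (lucas (2*n)).
         gamma_minus N = gamma_minus (N - lucas (2*n)) @ [1, 0]) \<and>
      (\<forall>N \<in> translate (lucas_interval (2*n - 2)) (lucas (2*n + 1)).
         gamma_minus N = gamma_minus (N - lucas (2*n + 1)) @ [0, 0, 1, 0]) \<and>
      (\<forall>N \<in> translate (lucas_interval (2*n - 1)) (lucas (2*n + 1)).
         gamma_minus N = gamma_minus (N - lucas (2*n + 1)) @ [0, 0]))
    \<and> (\<forall>n\<ge>1.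
      consecutive_intervals
        (translate (lucas_interval (2*n)) (lucas (2*n + 1)))
        (translate (lucas_interval (2*n - 1)) (lucas (2*n + 2)))
        (translate (lucas_interval (2*n)) (lucas (2*n + 2))) \<and>
      lucas_interval (2*n + 2) =
        translate (lucas_interval (2*n)) (lucas (2*n + 1)) \<union>
        translate (lucas_interval (2*n - 1)) (lucas (2*n + 2)) \<union>
        translate (lucas_interval (2*n)) (lucas (2*n + 2)) \<and>
      (\<forall>N \<in> translate (lucas_interval (2*n)) (lucas (2*n + 1)).
         gamma_minus N = gamma_minus (N - lucas (2*n + 1)) @ [0, 0]) \<and>
      (\<forall>N \<in> translate (lucas_interval (2*n - 1)) (lucas (2*n + 2)).
         gamma_minus N = gamma_minus (N - lucas (2*n + 2)) @ [0, 1]) \<and>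
      (\<forall>N \<in> translate (lucas_interval (2*n)) (lucas (2*n + 2)).
         gamma_minus N = gamma_minus (N - lucas (2*n + 2)) @ [0, 1]))"
proof (intro conjI[of "\<forall>n\<ge>1. P n" "\<forall>n\<ge>1. Q n" for P Q] allI impI, goal_cases)
  case (1 n)
  then obtain m where n: "n = m + 1"
    using le_Suc_ex[of 1 n] by (auto simp: add.commute)
  \<comment> \<open>With n = m + 1 the truncated subtractions disappear and the indices match those
    of the splitting and addition lemmas.\<close>
  have idx: "2 * n - 1 = 2 * m + 1" "2 * n - 2 = 2 * m" "2 * n = 2 * m + 2" "2 * m + 2 + 1 = 2 * m + 3"
    by (auto simp: n)
  have "m \<ge> 1" if "M \<in> lucas_interval (2 * m)" for M
    using that by (cases m) (auto simp: lucas_interval_def)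
  then show ?case
    unfolding idx
    using odd_interval_split[of m] types_of_lucas_intervals[of m]
      odd_add_even_lucas(2)[of m] even_add_odd_lucas_skip(2)[of m] odd_add_odd_lucas(2)[of m]
    by (auto simp: translate_def simp del: lucas.simps)
next
  case (2 n)
  then obtain m where n: "n = m + 1"
    using le_Suc_ex[of 1 n] by (auto simp: add.commute)
  have idx: "2 * n - 1 = 2 * m + 1" "2 * n = 2 * m + 2" "2 * m + 2 + 1 = 2 * m + 3"
      "2 * m + 2 + 2 = 2 * m + 4"
    by (auto simp: n)
  have idx': "2 * (m + 1) + 1 = 2 * m + 3" "2 * (m + 1) + 2 = 2 * m + 4"
    by simp_all
  \<comment> \<open>The even interval has index 2(m+1), so the addition lemmas apply at
    \<open>m + 1\<close>, which is at least 1.\<close>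
  have steps: "gamma_minus (M + lucas (2 * m + 3)) = gamma_minus M @ [0, 0]"
    "gamma_minus (M + lucas (2 * m + 4)) = gamma_minus M @ [0, 1]"
    if "M \<in> lucas_interval (2 * m + 2)" for M
    using that types_of_lucas_intervals[of m] even_add_odd_lucas(2)[of "m + 1" M, unfolded idx']
      even_add_even_lucas(2)[of "m + 1" M, unfolded idx']
    by (simp_all del: lucas.simps)
  show ?case
    unfolding idx
    using even_interval_split[of m] types_of_lucas_intervals[of m] steps
      odd_add_even_lucas_skip(2)[of m]
    by (auto simp: translate_def simp del: lucas.simps)
qed

end
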